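(* Let $v, w \in S_n$ be fully commutative permutations such that $w = v s_i$ with $\ell(w) = \ell(v) + 1$. Then $\mathrm{Row}_1(P(v)) \supseteq \mathrm{Row}_1(P(w))$; equivalently, $\mathrm{Row}_2(P(v)) \subseteq \mathrm{Row}_2(P(w))$.
   Context: $s_i$ is the simple reflection swapping $i$ and $i+1$, and $\ell$ denotes Coxeter length (number of inversions); $w = vs_i$ means $w$ is obtained from the one-line notation of $v$ by swapping the entries in positions $i$ and $i+1$. A permutation is fully commutative iff it avoids the pattern $321$. $P(w)$ denotes the RSK (row-insertion) insertion tableau of the one-line notation $w(1)\cdots w(n)$; for fully commutative $w$ it has at most two rows. For a tableau $T$, $\mathrm{Row}_1(T)$ and $\mathrm{Row}_2(T)$ denote the sets of entries in its first and second rows. *)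

theory Defs
  imports "HOL-Combinatorics.Permutations"
begin

text \<open>
  An element of \<open>S\<^sub>n\<close> is a function \<open>w :: nat \<Rightarrow> nat\<close> with \<open>w permutes {1..n}\<close>.
  The product is composition of functions, so right multiplication by \<open>simple_refl i\<close>
  swaps the entries in positions \<open>i\<close> and \<open>i + 1\<close> of the one-line notation.
\<close>

definition simple_refl :: "nat \<Rightarrow> nat \<Rightarrow> nat" where
  "simple_refl i = Transposition.transpose i (i + 1)"

definition one_line :: "nat \<Rightarrow> (nat \<Rightarrow> nat) \<Rightarrow> nat list" where
  "one_line n w = map w [1..<n + 1]"

definition inversions :: "nat \<Rightarrow> (nat \<Rightarrow> nat) \<Rightarrow> (nat \<times> nat) set" where
  "inversions n w = {(a, b). a \<in> {1..n} \<and> b \<in> {1..n} \<and> a < b \<and> w b < w a}"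

definition coxeter_length :: "nat \<Rightarrow> (nat \<Rightarrow> nat) \<Rightarrow> nat" where
  "coxeter_length n w = card (inversions n w)"

text \<open>Full commutativity, as avoidance of the pattern \<open>321\<close>.\<close>

definition fully_commutative :: "nat \<Rightarrow> (nat \<Rightarrow> nat) \<Rightarrow> bool" where
  "fully_commutative n w \<longleftrightarrow>
     \<not> (\<exists>a\<in>{1..n}. \<exists>b\<in>{1..n}. \<exists>c\<in>{1..n}. a < b \<and> b < c \<and> w c < w b \<and> w b < w a)"

text \<open>
  A tableau is the list of its rows, first row first. Inserting \<open>x\<close> into a row replaces the
  leftmost entry greater than \<open>x\<close>, which is returned as the bumped entry; if there is none,
  \<open>x\<close> is appended and nothing is bumped. A bumped entry is inserted into the next row.
\<close>

fun row_insert :: "nat \<Rightarrow> nat list \<Rightarrow> nat list \<times> nat option" where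
  "row_insert x [] = ([x], None)"
| "row_insert x (y # ys) =
     (if x < y then (x # ys, Some y)
      else (case row_insert x ys of (zs, b) \<Rightarrow> (y # zs, b)))"

fun tableau_insert :: "nat \<Rightarrow> nat list list \<Rightarrow> nat list list" where
  "tableau_insert x [] = [[x]]"
| "tableau_insert x (r # rs) =
     (case row_insert x r of
        (r', None) \<Rightarrow> r' # rs
      | (r', Some y) \<Rightarrow> r' # tableau_insert y rs)"

definition insertion_tableau :: "nat \<Rightarrow> (nat \<Rightarrow> nat) \<Rightarrow> nat list list" where
  "insertion_tableau n w = fold tableau_insert (one_line n w) []"

text \<open>The set of entries in the \<open>k\<close>-th row, counted from \<open>1\<close>; empty if there is no such row.\<close>

definition row_entries :: "nat \<Rightarrow> nat list list \<Rightarrow> nat set" where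
  "row_entries k T = (if 1 \<le> k \<and> k \<le> length T then set (T ! (k - 1)) else {})"

end

theory Submission
  imports Defs "HOL-Library.Sublist"
begin

text \<open>
  Inserting \<open>x\<close> changes the set \<open>R\<close> of entries of the first row into \<open>R\<close> with \<open>x\<close> added and the
  least element of \<open>R\<close> above \<open>x\<close> removed; this operation is monotone in \<open>R\<close>. The one-line notations
  are \<open>v = u a b t\<close> and \<open>w = u b a t\<close> with \<open>a < b\<close>, and as \<open>w\<close> avoids \<open>321\<close> no entry of \<open>u\<close>
  exceeds \<open>b\<close>. Hence \<open>u a b\<close> and \<open>u b a\<close> give the same first row, unless no entry of the row of \<open>u\<close>
  exceeds \<open>a\<close>, in which case the row of \<open>u b a\<close> merely lacks \<open>b\<close>. Monotonicity carries this
  inclusion through \<open>t\<close>. For the second rows, the elements bumped from the first row of a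
  \<open>321\<close>-avoiding word form an increasing sequence, so there is no third row and the second row
  is the complement of the first.
\<close>

section \<open>Bumping as an operation on sets of entries\<close>

definition bump_set :: "nat \<Rightarrow> nat set \<Rightarrow> nat set" where
  "bump_set x R = insert x (R - {y. x < y \<and> (\<forall>z\<in>R. x < z \<longrightarrow> y \<le> z)})"

text \<open>An element y > x of R survives when some element of R lies strictly between x and y;
  that element is also in S, so y survives there too.\<close>

lemma bump_set_mono: "R \<subseteq> S \<Longrightarrow> bump_set x R \<subseteq> bump_set x S"
  unfolding bump_set_def by blast

lemma fold_bump_set_mono: "R \<subseteq> S \<Longrightarrow> fold bump_set xs R \<subseteq> fold bump_set xs S"
  by (induction xs arbitrary: R S) (auto dest: bump_set_mono)

lemma fold_bump_set_subset: "fold bump_set xs R \<subseteq> set xs \<union> R"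
proof (induction xs arbitrary: R)
  case (Cons x xs)
  have "bump_set x R \<subseteq> insert x R" by (auto simp: bump_set_def)
  then show ?case using Cons[of "bump_set x R"] by auto
qed simp

lemma bump_set_swap:
  assumes "a < b" and "\<forall>z\<in>R. z < b"
  shows "bump_set a (bump_set b R) \<subseteq> bump_set b (bump_set a R)"
proof -
  have b: "bump_set b R = insert b R"
    using assms by (auto simp: bump_set_def)
  have "bump_set b (bump_set a R) = insert b (bump_set a R)"
    using assms by (auto simp: bump_set_def)
  \<comment> \<open>As b exceeds all of R, a bumps b only if R has nothing above a; otherwise both
    sides lose the same element of R.\<close>
  moreover have "bump_set a (insert b R) \<subseteq> insert b (bump_set a R)"
    using assms by (auto simp: bump_set_def)
  ultimately show ?thesis using b by simp
qed

section \<open>Row insertion into an increasing row\<close>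

lemma row_insert_None:
  assumes "row_insert x r = (r', None)" and "x \<notin> set r"
  shows "r' = r @ [x] \<and> (\<forall>z\<in>set r. z < x)"
  using assms by (induction r arbitrary: r') (auto split: if_splits prod.splits)

lemma row_insert_above:
  "\<forall>z\<in>set r. z < x \<Longrightarrow> row_insert x r = (r @ [x], None)"
  by (induction r) auto

lemma row_insert_Some:
  assumes "row_insert x r = (r', Some y)" and "x \<notin> set r" and "sorted_wrt (<) r"
  shows "y \<in> set r \<and> x < y \<and> (\<forall>z\<in>set r. x < z \<longrightarrow> y \<le> z) \<and>
         set r' = insert x (set r - {y}) \<and> sorted_wrt (<) r'"
  using assms
proof (induction r arbitrary: r')
  case (Cons z zs)
  show ?case
  proof (cases "x < z")
    case True
    then show ?thesis using Cons.prems by fastforce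
  next
    case False
    then obtain zs' where zs': "row_insert x zs = (zs', Some y)" "r' = z # zs'"
      using Cons.prems by (auto split: prod.splits)
    with Cons False show ?thesis by fastforce
  qed
qed simp

lemma row_insert_sorted_set:
  assumes "row_insert x r = (r', b)" and "x \<notin> set r" and "sorted_wrt (<) r"
  shows "sorted_wrt (<) r' \<and> set r' = bump_set x (set r)"
proof (cases b)
  case None
  then have "r' = r @ [x]" "\<forall>z\<in>set r. z < x" using row_insert_None assms by blast+
  then show ?thesis using assms by (auto simp: sorted_wrt_append bump_set_def)
next
  case (Some y)
  with row_insert_Some[of x r r' y] assms
  have y: "y \<in> set r" "x < y" "\<forall>z\<in>set r. x < z \<longrightarrow> y \<le> z"
    and r': "set r' = insert x (set r - {y})" "sorted_wrt (<) r'" by blast+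
  have "set r \<inter> {u. x < u \<and> (\<forall>z\<in>set r. x < z \<longrightarrow> u \<le> z)} = {y}"
    using y by (auto intro: order.antisym)
  then show ?thesis using r' unfolding bump_set_def by blast
qed

section \<open>Two-row shape for words avoiding 321\<close>

text \<open>
  The last condition of this invariant records why a second-row entry \<open>y\<close> exceeds a first-row
  entry \<open>z\<close>: a bump of \<open>z\<close> by some \<open>x'\<close> would give the pattern \<open>321\<close> as \<open>y x x'\<close>. The filter
  drops empty rows.
\<close>

definition two_row_state :: "nat list \<Rightarrow> nat list \<Rightarrow> nat list \<Rightarrow> nat list list \<Rightarrow> bool" where
  "two_row_state xs r s T \<longleftrightarrow>
     T = filter (\<lambda>q. q \<noteq> []) [r, s] \<and> (r = [] \<longrightarrow> s = []) \<and>
     sorted_wrt (<) r \<and> set r \<union> set s = set xs \<and> set r \<inter> set s = {} \<and>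
     (\<forall>y\<in>set s. \<forall>z\<in>set r. z < y \<longrightarrow> (\<exists>x. z \<le> x \<and> x < y \<and> subseq [y, x] xs))"

text \<open>Word counterpart of \<open>fully_commutative\<close>, suited to induction on
  prefixes.\<close>

definition avoids_321 :: "nat list \<Rightarrow> bool" where
  "avoids_321 xs \<longleftrightarrow> \<not> (\<exists>c b a. subseq [c, b, a] xs \<and> a < b \<and> b < c)"

lemma subseq_snoc_mono: "subseq ys xs \<Longrightarrow> subseq (ys @ [x]) (xs @ [x])"
  by (simp add: list_emb_append_mono)

lemma two_row_state_step:
  assumes st: "two_row_state xs r s T" and new: "x \<notin> set xs" and av: "avoids_321 (xs @ [x])"
  shows "\<exists>r' s'. two_row_state (xs @ [x]) r' s' (tableau_insert x T)"
proof -
  from st have T: "T = filter (\<lambda>q. q \<noteq> []) [r, s]" and rs: "r = [] \<longrightarrow> s = []"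
    and sorted: "sorted_wrt (<) r" and un: "set r \<union> set s = set xs"
    and disj: "set r \<inter> set s = {}"
    and hist: "\<And>y z. y \<in> set s \<Longrightarrow> z \<in> set r \<Longrightarrow> z < y \<Longrightarrow>
                 \<exists>x. z \<le> x \<and> x < y \<and> subseq [y, x] xs"
    unfolding two_row_state_def by blast+
  have x: "x \<notin> set r" "x \<notin> set s" using new un by auto
  have before: "subseq [y, x] (xs @ [x])" if "y \<in> set xs" for y
    using subseq_snoc_mono[of "[y]" xs x] that by (simp add: subseq_singleton_left)
  \<comment> \<open>For the new entry z = x the witness is x itself, which y precedes in the
    word.\<close>
  have hist': "\<exists>m. z \<le> m \<and> m < y \<and> subseq [y, m] (xs @ [x])"
    if yz: "y \<in> set s" "z \<in> insert x (set r)" "z < y" for y z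
  proof (cases "z = x")
    case True
    then show ?thesis using before[of y] yz un by auto
  next
    case False
    then obtain m where "z \<le> m" "m < y" "subseq [y, m] xs" using hist yz by blast
    then show ?thesis by (meson list_emb_prefix)
  qed
  obtain r' b where ins: "row_insert x r = (r', b)" by fastforce
  show ?thesis
  proof (cases b)
    case None
    then have r': "r' = r @ [x]" "\<forall>z\<in>set r. z < x" using row_insert_None ins x by blast+
    have Tn: "tableau_insert x T = filter (\<lambda>q. q \<noteq> []) [r', s]"
      using T rs ins None r' by (auto split: if_splits)
    have "two_row_state (xs @ [x]) r' s (tableau_insert x T)"
      unfolding two_row_state_def Tn
      using r' sorted un disj x hist' by (auto simp: sorted_wrt_append)
    then show ?thesis by blast
  next
    case (Some y)
    have y: "y \<in> set r" "x < y" "\<forall>z\<in>set r. x < z \<longrightarrow> y \<le> z"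
      and r': "set r' = insert x (set r - {y})" "sorted_wrt (<) r'"
      using row_insert_Some[of x r r' y] ins x sorted Some by blast+
    have "r \<noteq> []" "r' \<noteq> []" using y r' by auto
    \<comment> \<open>A larger second-row entry z would come with a witness m, y \<le> m < z; as x <
      y, the word would contain the 321 pattern z, m, x. Hence y goes to the end of
      \<open>s\<close>.\<close>
    have above: "\<forall>z\<in>set s. z < y"
    proof (rule ccontr)
      assume "\<not> ?thesis"
      then obtain z where z: "z \<in> set s" "\<not> z < y" by blast
      then have "y < z" using y disj by (metis disjoint_iff linorder_neqE_nat)
      then obtain m where m: "y \<le> m" "m < z" "subseq [z, m] xs" using hist z y by blast
      then have "subseq [z, m, x] (xs @ [x])" using subseq_snoc_mono by fastforce
      then show False using av m y unfolding avoids_321_def by (meson order_less_le_trans)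
    qed
    have "tableau_insert x T = [r', s @ [y]]"
      using T \<open>r \<noteq> []\<close> ins Some row_insert_above[OF above] by auto
    then have Tn: "tableau_insert x T = filter (\<lambda>q. q \<noteq> []) [r', s @ [y]]"
      using \<open>r' \<noteq> []\<close> by simp
    \<comment> \<open>The witness is x: since y was the least entry above x, every entry of
      \<open>r'\<close> below y is at most x.\<close>
    have "\<exists>m. z \<le> m \<and> m < y \<and> subseq [y, m] (xs @ [x])" if "z \<in> set r'" "z < y" for z
    proof -
      have "z \<le> x" using that r' y by force
      then show ?thesis using before[of y] y un by auto
    qed
    then have "two_row_state (xs @ [x]) r' (s @ [y]) (tableau_insert x T)"
      unfolding two_row_state_def Tn
      using r' \<open>r' \<noteq> []\<close> y un disj x hist' by auto
    then show ?thesis by blast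
  qed
qed

lemma avoids_321_subseq: "avoids_321 ys \<Longrightarrow> subseq xs ys \<Longrightarrow> avoids_321 xs"
  unfolding avoids_321_def by (meson subseq_order.trans)

lemma two_row_state_exists:
  assumes "distinct xs" and "avoids_321 xs"
  shows "\<exists>r s. two_row_state xs r s (fold tableau_insert xs [])"
  using assms
proof (induction xs rule: rev_induct)
  case Nil
  have "two_row_state [] [] [] []" by (simp add: two_row_state_def)
  then show ?case by auto
next
  case (snoc x xs)
  have "avoids_321 xs" by (rule avoids_321_subseq[OF snoc.prems(2)]) (simp add: list_emb_prefix)
  then obtain r s where "two_row_state xs r s (fold tableau_insert xs [])"
    using snoc by auto
  with two_row_state_step[OF this] snoc.prems show ?case by auto
qed

section \<open>Row sets of the insertion tableau\<close>

lemma row_entries_two_row_state: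
  assumes "two_row_state xs r s T"
  shows "row_entries 1 T = set r" and "row_entries 2 T = set s"
  using assms by (auto simp: two_row_state_def row_entries_def)

lemma row_entries_2_eq:
  assumes "distinct xs" and "avoids_321 xs"
  shows "row_entries 2 (fold tableau_insert xs []) =
         set xs - row_entries 1 (fold tableau_insert xs [])"
proof -
  obtain r s where st: "two_row_state xs r s (fold tableau_insert xs [])"
    using two_row_state_exists[OF assms] by blast
  then have "set s = set xs - set r" unfolding two_row_state_def by blast
  then show ?thesis using row_entries_two_row_state[OF st] by simp
qed

text \<open>Entries only move down, so the first row evolves independently of the rows below;
  \<open>rs\<close> is arbitrary because it changes during the induction.\<close>

lemma row_entries_1_fold:
  assumes "distinct xs" and "sorted_wrt (<) r" and "set xs \<inter> set r = {}"
  shows "row_entries 1 (fold tableau_insert xs (r # rs)) = fold bump_set xs (set r)"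
  using assms
proof (induction xs arbitrary: r rs)
  case (Cons x xs)
  obtain r' b where ins: "row_insert x r = (r', b)" by fastforce
  have r': "sorted_wrt (<) r'" "set r' = bump_set x (set r)"
    using row_insert_sorted_set[OF ins] Cons.prems by auto
  obtain rs' where T: "tableau_insert x (r # rs) = r' # rs'"
    using ins by (cases b) auto
  have "set xs \<inter> set r' = {}" using r' Cons.prems by (auto simp: bump_set_def)
  then show ?case using Cons.IH[of r' rs'] Cons.prems r' by (simp add: T del: tableau_insert.simps)
qed (simp add: row_entries_def)

lemma row_entries_1_eq:
  assumes "distinct xs"
  shows "row_entries 1 (fold tableau_insert xs []) = fold bump_set xs {}"
proof (cases xs)
  case (Cons x ys)
  then show ?thesis
    using row_entries_1_fold[of ys "[x]" "[]"] assms by (simp add: bump_set_def)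
qed (simp add: row_entries_def)

lemma row_entries_1_adjacent_swap:
  assumes "distinct (us @ a # b # ts)" and "a < b" and "avoids_321 (us @ b # a # ts)"
  shows "row_entries 1 (fold tableau_insert (us @ b # a # ts) []) \<subseteq>
         row_entries 1 (fold tableau_insert (us @ a # b # ts) [])"
proof -
  have "z < b" if "z \<in> set us" for z
  proof (rule ccontr)
    assume "\<not> z < b"
    moreover have "z \<noteq> b" using that assms(1) by auto
    ultimately have "b < z" by simp
    have "subseq ([z] @ [b, a]) (us @ (b # a # ts))"
      using that by (intro list_emb_append_mono) (auto simp: subseq_singleton_left)
    then show False using assms \<open>b < z\<close> unfolding avoids_321_def by auto
  qed
  then have "\<forall>z\<in>fold bump_set us {}. z < b" using fold_bump_set_subset[of us "{}"] by auto
  with \<open>a < b\<close> have "fold bump_set (us @ b # a # ts) {} \<subseteq> fold bump_set (us @ a # b # ts) {}"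
    by (simp add: bump_set_swap fold_bump_set_mono)
  moreover have "distinct (us @ b # a # ts)" using assms(1) by auto
  ultimately show ?thesis using assms(1) by (metis row_entries_1_eq)
qed

section \<open>From permutations to words\<close>

lemma avoids_321_one_line:
  assumes "fully_commutative n w"
  shows "avoids_321 (one_line n w)"
  unfolding avoids_321_def
proof clarify
  fix c b a
  assume sub: "subseq [c, b, a] (one_line n w)" and "a < b" "b < c"
  \<comment> \<open>A subsequence of the one-line notation is the image of a sublist of the
    positions, which is increasing.\<close>
  then obtain N where "[c, b, a] = map w (nths [1..<n + 1] N)"
    unfolding one_line_def subseq_conv_nths nths_map by metis
  then obtain p q r where pqr: "nths [1..<n + 1] N = [p, q, r]" "c = w p" "b = w q" "a = w r"
    by (auto simp: map_eq_Cons_conv Cons_eq_map_conv)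
  have "sorted (nths [1..<n + 1] N)" "distinct (nths [1..<n + 1] N)"
    by (simp_all add: sorted_nths distinct_nthsI del: upt_Suc)
  moreover have "set (nths [1..<n + 1] N) \<subseteq> {1..n}"
    using set_nths_subset[of "[1..<n + 1]" N] by (auto simp del: upt_Suc)
  ultimately have "p < q" "q < r" "p \<in> {1..n}" "q \<in> {1..n}" "r \<in> {1..n}"
    unfolding pqr by auto
  then show False
    using assms \<open>a < b\<close> \<open>b < c\<close> pqr unfolding fully_commutative_def by blast
qed

text \<open>Applying \<open>simple_refl i\<close> to both positions reverses the order of the pair
  (i, i + 1) alone, and this pair is no inversion after the swap; so inversions inject into
  inversions. By contraposition, an increase in length forces an ascent at i.\<close>

lemma coxeter_length_swap_descent:
  assumes "1 \<le> i" and "i < n" and "v (i + 1) < v i"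
  shows "coxeter_length n (v \<circ> simple_refl i) \<le> coxeter_length n v"
proof -
  let ?s = "simple_refl i"
  have "map_prod ?s ?s ` inversions n (v \<circ> ?s) \<subseteq> inversions n v"
    using assms
    by (auto simp: inversions_def simple_refl_def Transposition.transpose_def split: if_splits)
  moreover have "finite (inversions n v)"
    by (rule finite_subset[of _ "{1..n} \<times> {1..n}"]) (auto simp: inversions_def)
  moreover have "inj (map_prod ?s ?s)"
    by (auto simp: simple_refl_def intro: prod.inj_map)
  ultimately show ?thesis
    unfolding coxeter_length_def by (meson card_inj_on_le inj_on_subset subset_UNIV)
qed

theorem theorem3p4:
  fixes n i :: nat and v w :: "nat \<Rightarrow> nat"
  assumes "v permutes {1..n}" and "w permutes {1..n}"
    and "fully_commutative n v" and "fully_commutative n w"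
    and "1 \<le> i" and "i < n"
    and "w = v \<circ> simple_refl i"
    and "coxeter_length n w = coxeter_length n v + 1"
  shows "row_entries 1 (insertion_tableau n w) \<subseteq> row_entries 1 (insertion_tableau n v) \<and>
         row_entries 2 (insertion_tableau n v) \<subseteq> row_entries 2 (insertion_tableau n w)"
proof -
  have "v i \<noteq> v (i + 1)" using permutes_inj[OF assms(1)] by (auto dest: injD)
  moreover have "\<not> v (i + 1) < v i"
    using coxeter_length_swap_descent[of i n v] assms by auto
  ultimately have less: "v i < v (i + 1)" by simp
  let ?us = "map v [1..<i]" and ?ts = "map v [i + 2..<n + 1]"
  have upt: "[1..<n + 1] = [1..<i] @ i # (i + 1) # [i + 2..<n + 1]"
  proof -
    have "[1..<n + 1] = [1..<i] @ [i..<n + 1]"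
      using upt_add_eq_append[of 1 i "n + 1 - i"] assms by simp
    also have "[i..<n + 1] = i # (i + 1) # [i + 2..<n + 1]"
      using assms by (simp add: upt_conv_Cons del: upt_Suc)
    finally show ?thesis .
  qed
  have v: "one_line n v = ?us @ v i # v (i + 1) # ?ts"
    unfolding one_line_def upt by simp
  have w: "one_line n w = ?us @ v (i + 1) # v i # ?ts"
    unfolding one_line_def upt assms(7)
    by (auto simp: simple_refl_def Transposition.transpose_def simp del: upt_Suc)
  have dv: "distinct (one_line n v)" and dw: "distinct (one_line n w)"
    using permutes_inj[OF assms(1)] permutes_inj[OF assms(2)]
    by (auto simp: one_line_def distinct_map intro: inj_on_subset simp del: upt_Suc)
  have av: "avoids_321 (one_line n v)" and aw: "avoids_321 (one_line n w)"
    using avoids_321_one_line assms by blast+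
  have row1: "row_entries 1 (insertion_tableau n w) \<subseteq> row_entries 1 (insertion_tableau n v)"
    using row_entries_1_adjacent_swap[of ?us "v i" "v (i + 1)" ?ts] dv aw less
    unfolding insertion_tableau_def v w by blast
  \<comment> \<open>With equal sets of letters, passing to complements reverses the inclusion of
    first rows.\<close>
  have "set (one_line n v) = set (one_line n w)" unfolding v w by auto
  then show ?thesis
    using row1 row_entries_2_eq[OF dv av] row_entries_2_eq[OF dw aw]
    unfolding insertion_tableau_def by auto
qed

end
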